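(* For every integer $k \geq 2$ there exists a 2-connected outerplanar graph $G_k$ with exactly $30k+1$ vertices such that $z(G_k) \geq k$, i.e. for every placement of at most $k-1$ zombies on $G_k$ the survivor has a strategy to avoid capture forever.
   Context: All graphs are finite, simple and undirected. The (deterministic) zombies-and-survivor game on a connected graph $G$: in round $0$ the zombies choose starting vertices (several zombies may share a vertex), then the survivor chooses a starting vertex. In each subsequent round, first every zombie must move from its current vertex $u$ to a neighbour $w$ of $u$ that lies on a shortest path in $G$ from $u$ to the survivor's current vertex (if several such $w$ exist, the zombies choose); then the survivor either stays put or moves to an adjacent vertex. Both sides have full information. The zombies win if at some moment a zombie occupies the survivor's vertex; the survivor wins if this never happens. The zombie number $z(G)$ is the minimum number of zombies for which the zombies (choosing their starting positions) have a winning strategy. *)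

theory Defs
  imports
    "HOL-Analysis.Analysis"
    "Graph_Theory.Graph_Theory"
begin

text \<open>
  Finite simple undirected graphs are the \<^locale>\<open>pair_graph\<close>s: finite, loop-free,
  symmetric sets of arcs without parallel arcs.
\<close>

definition two_connected :: "'a pair_pre_digraph \<Rightarrow> bool" where
  "two_connected G \<longleftrightarrow>
     card (pverts G) > 2 \<and>
     (\<forall>X \<subseteq> pverts G. card X < 2 \<longrightarrow>
        Digraph_Component.connected (with_proj G \<restriction> (pverts G - X)))"

text \<open>
  The two arcs \<open>(u, v)\<close> and \<open>(v, u)\<close> represent one undirected edge and hence are drawn as
  the same curve, traversed in opposite directions.
\<close>

definition plane_drawing ::
  "'a pair_pre_digraph \<Rightarrow> ('a \<Rightarrow> complex) \<Rightarrow> ('a \<times> 'a \<Rightarrow> real \<Rightarrow> complex) \<Rightarrow> bool" where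
  "plane_drawing G \<phi> \<gamma> \<longleftrightarrow>
     inj_on \<phi> (pverts G) \<and>
     (\<forall>(u, v) \<in> parcs G.
        arc (\<gamma> (u, v)) \<and> pathstart (\<gamma> (u, v)) = \<phi> u \<and> pathfinish (\<gamma> (u, v)) = \<phi> v \<and>
        \<gamma> (v, u) = reversepath (\<gamma> (u, v)) \<and>
        path_image (\<gamma> (u, v)) \<inter> \<phi> ` pverts G = {\<phi> u, \<phi> v}) \<and>
     (\<forall>e \<in> parcs G. \<forall>f \<in> parcs G. f \<noteq> e \<and> f \<noteq> prod.swap e \<longrightarrow>
        path_image (\<gamma> e) \<inter> path_image (\<gamma> f) \<subseteq> \<phi> ` pverts G)"

definition drawing_points ::
  "'a pair_pre_digraph \<Rightarrow> ('a \<Rightarrow> complex) \<Rightarrow> ('a \<times> 'a \<Rightarrow> real \<Rightarrow> complex) \<Rightarrow> complex set" where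
  "drawing_points G \<phi> \<gamma> = \<phi> ` pverts G \<union> (\<Union>e \<in> parcs G. path_image (\<gamma> e))"

text \<open>
  For a drawing \<open>D\<close> of a finite graph, \<open>outside D\<close> is the unbounded face.
\<close>

definition outerplanar :: "'a pair_pre_digraph \<Rightarrow> bool" where
  "outerplanar G \<longleftrightarrow>
     (\<exists>\<phi> \<gamma>. plane_drawing G \<phi> \<gamma> \<and>
        \<phi> ` pverts G \<subseteq> frontier (outside (drawing_points G \<phi> \<gamma>)))"

definition shortest_path :: "'a pair_pre_digraph \<Rightarrow> 'a \<Rightarrow> ('a \<times> 'a) awalk \<Rightarrow> 'a \<Rightarrow> bool" where
  "shortest_path G u p v \<longleftrightarrow>
     pre_digraph.apath (with_proj G) u p v \<and>
     (\<forall>q. pre_digraph.apath (with_proj G) u q v \<longrightarrow> length p \<le> length q)"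

definition zombie_move :: "'a pair_pre_digraph \<Rightarrow> 'a \<Rightarrow> 'a \<Rightarrow> 'a \<Rightarrow> bool" where
  "zombie_move G s u w \<longleftrightarrow>
     (u, w) \<in> parcs G \<and>
     (\<exists>p. shortest_path G u p s \<and> w \<in> set (pre_digraph.awalk_verts (with_proj G) u p))"

text \<open>
  The positions of \<open>n\<close> zombies are a list of length \<open>n\<close>, whose \<open>i\<close>-th entry is the vertex
  of the \<open>i\<close>-th zombie.
\<close>

definition zombies_move :: "'a pair_pre_digraph \<Rightarrow> 'a \<Rightarrow> 'a list \<Rightarrow> 'a list \<Rightarrow> bool" where
  "zombies_move G s = list_all2 (zombie_move G s)"

definition survivor_move :: "'a pair_pre_digraph \<Rightarrow> 'a \<Rightarrow> 'a \<Rightarrow> bool" where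
  "survivor_move G s s' \<longleftrightarrow> s' = s \<or> (s, s') \<in> parcs G"

text \<open>
  A play is a pair of sequences \<open>Z\<close>, \<open>S\<close>, where \<open>Z t\<close> and \<open>S t\<close> are the positions of the
  zombies and of the survivor after their respective moves in round \<open>t\<close>. The survivor can be
  caught in round \<open>t\<close> after the zombies' move, when still on \<open>S (t - 1)\<close>, or after the own move.
\<close>

definition caught :: "(nat \<Rightarrow> 'a list) \<Rightarrow> (nat \<Rightarrow> 'a) \<Rightarrow> nat \<Rightarrow> bool" where
  "caught Z S t \<longleftrightarrow> (t > 0 \<and> S (t - 1) \<in> set (Z t)) \<or> S t \<in> set (Z t)"

text \<open>
  A strategy maps the opponent's moves made so far to the next own move. As the zombies move
  first, they choose \<open>Z t\<close> knowing \<open>S 0, \<dots>, S (t - 1)\<close>, and the survivor chooses \<open>S t\<close>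
  knowing \<open>Z 0, \<dots>, Z t\<close>; in particular \<open>\<tau> []\<close> is the zombies' starting position.

  The play ends with a capture, so zombies need not have a legal move afterwards. Therefore a
  winning zombie strategy is only required to move legally until some capture, and a survivor
  strategy is judged on all finite plays in which the zombies have moved legally.
\<close>

definition zombie_strategy_wins :: "'a pair_pre_digraph \<Rightarrow> ('a list \<Rightarrow> 'a list) \<Rightarrow> bool" where
  "zombie_strategy_wins G \<tau> \<longleftrightarrow>
     (\<forall>S. let Z = (\<lambda>t. \<tau> (map S [0..<t])) in
        S 0 \<in> pverts G \<and> (\<forall>t. survivor_move G (S t) (S (Suc t))) \<longrightarrow>
        (\<exists>T. (\<forall>t<T. zombies_move G (S t) (Z t) (Z (Suc t))) \<and> caught Z S T))"

definition zombies_win :: "'a pair_pre_digraph \<Rightarrow> nat \<Rightarrow> bool" where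
  "zombies_win G n \<longleftrightarrow>
     (\<exists>\<tau>. length (\<tau> []) = n \<and> set (\<tau> []) \<subseteq> pverts G \<and> zombie_strategy_wins G \<tau>)"

definition zombie_number :: "'a pair_pre_digraph \<Rightarrow> nat" where
  "zombie_number G = (LEAST n. zombies_win G n)"

definition survivor_strategy_wins ::
  "'a pair_pre_digraph \<Rightarrow> 'a list \<Rightarrow> ('a list list \<Rightarrow> 'a) \<Rightarrow> bool" where
  "survivor_strategy_wins G Z0 \<sigma> \<longleftrightarrow>
     (\<forall>Z T. let S = (\<lambda>t. \<sigma> (map Z [0..<Suc t])) in
        Z 0 = Z0 \<and> (\<forall>t<T. zombies_move G (S t) (Z t) (Z (Suc t))) \<longrightarrow>
        S 0 \<in> pverts G \<and> (\<forall>t<T. survivor_move G (S t) (S (Suc t))) \<and> \<not> caught Z S T)"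

text \<open>The minimum in the zombie number is over a nonempty set.\<close>

lemma zombies_win_card:
  assumes "finite (pverts G)"
  shows "zombies_win G (card (pverts G))"
proof -
  obtain vs where vs: "set vs = pverts G" "distinct vs"
    using finite_distinct_list[OF assms] by blast
  have "zombie_strategy_wins G (\<lambda>_. vs)"
    unfolding zombie_strategy_wins_def Let_def caught_def
    by (intro allI impI exI[of _ 0]) (simp add: vs)
  then show ?thesis
    unfolding zombies_win_def
    by (intro exI[of _ "\<lambda>_. vs"]) (simp add: vs(1) flip: distinct_card[OF vs(2)])
qed

end

theory Submission
  imports Defs
begin

text \<open>
  The graph consists of \<open>k\<close> gadgets around a hub. In each gadget a 13-cycle through the hub
  shares an edge with a 19-cycle, and one further neighbour of the hub joins the gadget to the
  next one. No vertex is more than 12 steps away from the hub.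

  Fewer than \<open>k\<close> zombies leave some gadget empty, and they have to enter it through the
  hub or through one of the two joining vertices next to it. The survivor starts in this gadget two
  steps from the hub, runs to the 19-cycle along the longer side of the 13-cycle, and then circles
  in the 19-cycle forever. The zombies that enter early run after the survivor. Those that enter
  later take the shorter side of the 13-cycle and thereby make up for their delay, but they still
  reach the 19-cycle behind the survivor. Once the survivor is half way round the 19-cycle, all
  zombies are between 2 and 9 steps behind; this is less than half of 19, so they follow the
  survivor forever.

  The walk does not depend on the zombies, so it suffices to follow the set of all vertices that
  a single zombie can possibly occupy after each round.
\<close>

section \<open>Zombie moves and evading walks\<close>

context pair_graph
begin

lemma potential_le_length:
  fixes d :: "'a \<Rightarrow> nat"
  assumes "\<And>x y. (x, y) \<in> parcs G \<Longrightarrow> d x \<le> Suc (d y)" and "awalk u p v"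
  shows "d u \<le> length p + d v"
  using assms(2)
proof (induction p arbitrary: u)
  case (Cons e p)
  then have "d u \<le> Suc (d (snd e))"
    using assms(1)[of u "snd e"] by (auto simp: awalk_Cons_iff)
  moreover have "d (snd e) \<le> length p + d v"
    using Cons by (auto simp: awalk_Cons_iff)
  ultimately show ?case by simp
qed (auto simp: awalk_Nil_iff)

text \<open>Repeatedly stepping to a neighbour of smaller \<open>d\<close> must end at
  \<open>s\<close>. The bound on \<open>d\<close> along the path is carried through the induction
  because it keeps the path simple.\<close>

lemma apath_of_descent:
  fixes d :: "'a \<Rightarrow> nat"
  assumes "\<And>x. x \<in> pverts G \<Longrightarrow> x \<noteq> s \<Longrightarrow> \<exists>y. (x, y) \<in> parcs G \<and> d y < d x"
    and "u \<in> pverts G"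
  shows "\<exists>p. apath u p s \<and> length p \<le> d u \<and> (\<forall>x \<in> set (pawalk_verts u p). d x \<le> d u)"
  using assms(2)
proof (induction "d u" arbitrary: u rule: less_induct)
  case less
  show ?case
  proof (cases "u = s")
    case True
    then show ?thesis using less.prems by (intro exI[of _ "[]"]) (auto simp: apath_Nil_iff)
  next
    case False
    then obtain y where y: "(u, y) \<in> parcs G" "d y < d u"
      using assms(1) less.prems by blast
    then obtain p where p: "apath y p s" "length p \<le> d y" "\<forall>x \<in> set (pawalk_verts y p). d x \<le> d y"
      using less.hyps[of y] in_arcsD2 by blast
    show ?thesis
    proof (intro exI conjI)
      show "apath u ((u, y) # p) s"
        using y p by (auto simp: apath_Cons_iff)
    qed (use y p in auto)
  qed
qed

text \<open>The assumptions characterise \<open>d\<close> as the distance to \<open>s\<close>.\<close>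

lemma zombie_move_descends:
  fixes d :: "'a \<Rightarrow> nat"
  assumes "zombie_move G s u w"
    and "d s = 0"
    and "\<And>x y. (x, y) \<in> parcs G \<Longrightarrow> d x \<le> Suc (d y)"
    and "\<And>x. x \<in> pverts G \<Longrightarrow> x \<noteq> s \<Longrightarrow> \<exists>y. (x, y) \<in> parcs G \<and> d y < d x"
  shows "d w < d u"
proof -
  obtain p where uw: "(u, w) \<in> parcs G" and p: "shortest_path G u p s"
    and w: "w \<in> set (pawalk_verts u p)"
    using assms(1) unfolding zombie_move_def by auto
  have "apath u p s"
    using p unfolding shortest_path_def by simp
  then have walk: "awalk u p s" by (rule awalkI_apath)
  \<comment> \<open>The vertex \<open>w\<close> cuts the shortest path into a nonempty piece
    \<open>q\<close> and a rest \<open>r\<close>. So \<open>r\<close> is shorter than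
    \<open>p\<close>, while \<open>d w\<close> is at most the length of \<open>r\<close>.\<close>
  obtain q r where qr: "p = q @ r" "awalk u q w" "awalk w r s"
    using awalk_decomp[OF walk w] by blast
  have "u \<noteq> w" using pair_no_loops[OF uw] by simp
  then have "q \<noteq> []" using qr(2) by (auto simp: awalk_Nil_iff)
  moreover obtain p' where "apath u p' s" "length p' \<le> d u"
    using apath_of_descent[of s d u, OF assms(4)] in_arcsD1[OF uw] by blast
  then have "length p \<le> d u"
    using p unfolding shortest_path_def by (meson le_trans)
  moreover have "d w \<le> length r"
    using potential_le_length[of d, OF assms(3) qr(3)] assms(2) by simp
  ultimately show ?thesis using qr(1) by (cases q) auto
qed

end

text \<open>The walk is fixed in advance and must survive all legal replies, so it serves both as a
  survivor strategy and as a refutation of any zombie strategy from \<open>Z0\<close>.\<close>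

definition evading_walk :: "'a pair_pre_digraph \<Rightarrow> 'a list \<Rightarrow> (nat \<Rightarrow> 'a) \<Rightarrow> bool" where
  "evading_walk G Z0 S \<longleftrightarrow>
     S 0 \<in> pverts G \<and> (\<forall>t. survivor_move G (S t) (S (Suc t))) \<and>
     (\<forall>Z T. Z 0 = Z0 \<and> (\<forall>t<T. zombies_move G (S t) (Z t) (Z (Suc t))) \<longrightarrow> \<not> caught Z S T)"

text \<open>Given the survivor's position, zombies move independently, so an invariant of a single
  zombie suffices. \<open>step\<close> excludes capture by the zombies' move and
  \<open>avoid\<close> capture after the survivor's move.\<close>

lemma evading_walk_by_invariant:
  assumes "S 0 \<in> pverts G" "\<And>t. survivor_move G (S t) (S (Suc t))"
    and init: "\<And>z. z \<in> set Z0 \<Longrightarrow> I 0 z"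
    and step: "\<And>t z w. I t z \<Longrightarrow> zombie_move G (S t) z w \<Longrightarrow> I (Suc t) w \<and> w \<noteq> S t"
    and avoid: "\<And>t. \<not> I t (S t)"
  shows "evading_walk G Z0 S"
  unfolding evading_walk_def
proof (intro conjI allI impI assms(1,2))
  fix Z T
  assume *: "Z 0 = Z0 \<and> (\<forall>t<T. zombies_move G (S t) (Z t) (Z (Suc t)))"
  have pred: "\<exists>z \<in> set (Z t). zombie_move G (S t) z w" if "w \<in> set (Z (Suc t))" "t < T" for t w
    using * that unfolding zombies_move_def list_all2_conv_all_nth by (metis in_set_conv_nth)
  have inv: "\<forall>z \<in> set (Z t). I t z" if "t \<le> T" for t
    using that
  proof (induction t)
    case 0
    then show ?case using * init by simp
  next
    case (Suc t)
    then show ?case using pred[of _ t] step by (metis Suc_le_eq less_or_eq_imp_le)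
  qed
  have "S m \<notin> set (Z T)" if "T = Suc m" for m
    using pred[of "S m" m] inv[of m] step that by (metis le_SucI lessI order_refl)
  then have "S (T - 1) \<notin> set (Z T)" if "T > 0"
    using that by (cases T) simp_all
  then show "\<not> caught Z S T"
    using inv[of T] avoid unfolding caught_def by blast
qed

text \<open>In round \<open>t\<close> the survivor has seen \<open>t + 1\<close> zombie positions,
  hence the \<open>- 1\<close>.\<close>

lemma survivor_strategy_of_evading_walk:
  assumes "evading_walk G Z0 S"
  shows "survivor_strategy_wins G Z0 (\<lambda>h. S (length h - 1))"
  using assms unfolding survivor_strategy_wins_def evading_walk_def by (auto simp: Let_def)

text \<open>The minimum is attained. If it were below \<open>k\<close>, playing against an optimal
  zombie strategy the walk that evades its starting position would give a play without
  capture.\<close>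

lemma zombie_number_ge:
  assumes "finite (pverts G)"
    and evade: "\<And>Z0. set Z0 \<subseteq> pverts G \<Longrightarrow> length Z0 < k \<Longrightarrow> \<exists>S. evading_walk G Z0 S"
  shows "k \<le> zombie_number G"
proof (rule ccontr)
  assume less: "\<not> k \<le> zombie_number G"
  have "zombies_win G (zombie_number G)"
    unfolding zombie_number_def using zombies_win_card[OF assms(1)] by (rule LeastI)
  then obtain \<tau> where \<tau>: "length (\<tau> []) = zombie_number G" "set (\<tau> []) \<subseteq> pverts G"
      "zombie_strategy_wins G \<tau>"
    unfolding zombies_win_def by blast
  then obtain S where S: "evading_walk G (\<tau> []) S"
    using evade[of "\<tau> []"] less by auto
  define Z where "Z t = \<tau> (map S [0..<t])" for t
  obtain T where "\<forall>t<T. zombies_move G (S t) (Z t) (Z (Suc t))" "caught Z S T"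
    using \<tau>(3) S unfolding zombie_strategy_wins_def evading_walk_def Let_def Z_def by blast
  moreover have "Z 0 = \<tau> []" by (simp add: Z_def)
  ultimately show False using S unfolding evading_walk_def by blast
qed

section \<open>Two-connected and outerplanar graphs with a Hamiltonian cycle\<close>

lemma two_connected_if_Hamiltonian:
  fixes G :: "nat pair_pre_digraph"
  assumes verts: "pverts G = {0..n}" and "n \<ge> 2"
    and arcs: "\<And>j. j < n \<Longrightarrow> (j, Suc j) \<in> parcs G" "(0, n) \<in> parcs G"
  shows "two_connected G"
  unfolding two_connected_def
proof (intro conjI allI impI)
  show "card (pverts G) > 2" using assms by simp
next
  fix X assume X: "X \<subseteq> pverts G" "card X < 2"
  have "finite X" using X(1) verts finite_subset by auto
  define V where "V = pverts G - X"
  define R where "R = {(u, v). u \<in> V \<and> v \<in> V \<and> ((u, v) \<in> parcs G \<or> (v, u) \<in> parcs G)}"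
  define H where "H = with_proj (mk_symmetric (with_proj G \<restriction> V))"
  have H: "verts H = V" "arcs_ends H = R"
    unfolding H_def mk_symmetric_def R_def
    by (auto simp: arcs_ends_def arc_to_ends_def)
  have V_sub: "V \<subseteq> {0..n}" by (auto simp: V_def verts)
  note trans = rtrancl_on_trans[of _ _ V R]
  have sym: "(v, u) \<in> rtrancl_on V R" if "(u, v) \<in> rtrancl_on V R" for u v
    using that
  proof (induction rule: rtrancl_on_induct)
    case base
    then show ?case by (rule rtrancl_on_refl)
  next
    case (step y z)
    then have "(z, y) \<in> rtrancl_on V R"
      by (auto intro!: rtrancl_on_into_rtrancl_on[OF rtrancl_on_refl] simp: R_def)
    then show ?case using step.IH trans by blast
  qed
  have run: "(a, b) \<in> rtrancl_on V R" if "a \<le> b" "{a..b} \<subseteq> V" for a b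
    using that
  proof (induction b rule: dec_induct)
    case base
    then show ?case by (auto intro: rtrancl_on_refl)
  next
    case (step m)
    then have "m \<in> V" "Suc m \<in> V" by auto
    then have "(m, Suc m) \<in> R" using arcs(1)[of m] V_sub by (force simp: R_def)
    moreover have "(a, m) \<in> rtrancl_on V R" using step by force
    ultimately show ?case using \<open>Suc m \<in> V\<close> by (auto intro: rtrancl_on_into_rtrancl_on)
  qed
  have "\<exists>x. X \<subseteq> {x}"
    using X(2) \<open>finite X\<close>
    by (metis One_nat_def card_1_singletonE card_eq_0_iff empty_subsetI less_2_cases order_refl)
  then obtain x where x: "X \<subseteq> {x}" by blast
  have sub: "{0..n} - {x} \<subseteq> V" using x by (auto simp: V_def verts)
  have conn: "(u, v) \<in> rtrancl_on V R" if "u \<in> V" "v \<in> V" "u \<le> v" for u v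
  proof (cases "{u..v} \<subseteq> V")
    case True
    then show ?thesis using run that by blast
  next
    \<comment> \<open>The deleted vertex lies strictly between \<open>u\<close> and
      \<open>v\<close>; the way round the other side of the cycle, through the closing edge
      \<open>(0, n)\<close>, is intact.\<close>
    case False
    then obtain y where "u \<le> y" "y \<le> v" "y \<notin> V" by (meson atLeastAtMost_iff subsetI)
    moreover have "y \<in> {0..n}" using \<open>y \<le> v\<close> that V_sub by auto
    then have "y = x" using sub \<open>y \<notin> V\<close> by blast
    ultimately have "u < x" "x < v" using that by (metis le_neq_implies_less)+
    moreover have "v \<le> n" using that V_sub by auto
    ultimately have "{0..u} \<subseteq> {0..n} - {x}" "{v..n} \<subseteq> {0..n} - {x}" by auto
    then have ivl: "{0..u} \<subseteq> V" "{v..n} \<subseteq> V" using sub by blast+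
    then have "0 \<in> V" "n \<in> V" using \<open>v \<le> n\<close> by auto
    with ivl have "(0, u) \<in> rtrancl_on V R" "(v, n) \<in> rtrancl_on V R" "(0, n) \<in> R"
      using run[of 0 u] run[of v n] that V_sub arcs(2) by (auto simp: R_def)
    moreover have "(0, n) \<in> rtrancl_on V R"
      using \<open>(0, n) \<in> R\<close> \<open>0 \<in> V\<close> \<open>n \<in> V\<close> by (auto intro: rtrancl_on_into_rtrancl_on[OF rtrancl_on_refl])
    ultimately show ?thesis using trans sym by blast
  qed
  have "(if x = 0 then 1 else 0) \<in> {0..n} - {x}" using \<open>n \<ge> 2\<close> by simp
  then have "V \<noteq> {}" using sub by blast
  moreover have "(u, v) \<in> rtrancl_on V R" if "u \<in> V" "v \<in> V" for u v
    using conn[of u v] conn[of v u] sym that by (cases "u \<le> v") auto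
  ultimately have "strongly_connected H"
    unfolding strongly_connected_def reachable_def H by blast
  then show "Digraph_Component.connected (with_proj G \<restriction> (pverts G - X))"
    unfolding Digraph_Component.connected_def H_def V_def .
qed

section \<open>Straight-line drawings with all vertices on a parabola\<close>

definition parabola_point :: "nat \<Rightarrow> complex" where
  "parabola_point n = Complex (real n) ((real n)\<^sup>2)"

lemma inj_parabola_point: "inj parabola_point"
  by (auto simp: inj_def parabola_point_def)

text \<open>The height of the chord above the parabola is a quadratic in \<open>Re z\<close> with
  leading coefficient -1 and roots \<open>a\<close> and \<open>b\<close>.\<close>

lemma chord_of_parabola:
  assumes "z \<in> closed_segment (parabola_point a) (parabola_point b)" "a \<le> b"
  shows "real a \<le> Re z" "Re z \<le> real b" "Im z - (Re z)\<^sup>2 = (Re z - real a) * (real b - Re z)"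
proof -
  obtain t where t: "0 \<le> t" "t \<le> 1" and z: "z = (1 - t) *\<^sub>R parabola_point a + t *\<^sub>R parabola_point b"
    using assms(1) by (auto simp: closed_segment_def)
  have re: "Re z = real a + t * (real b - real a)"
    by (simp add: z parabola_point_def algebra_simps)
  have im: "Im z = (1 - t) * (real a)\<^sup>2 + t * (real b)\<^sup>2"
    by (simp add: z parabola_point_def)
  show "real a \<le> Re z"
    using t assms(2) by (simp add: re)
  have "t * (real b - real a) \<le> 1 * (real b - real a)"
    using t assms(2) by (intro mult_right_mono) auto
  then show "Re z \<le> real b" by (simp add: re)
  show "Im z - (Re z)\<^sup>2 = (Re z - real a) * (real b - Re z)"
    unfolding re im by (simp add: power2_eq_square algebra_simps)
qed

lemma chord_point_on_parabola:
  assumes "z \<in> closed_segment (parabola_point a) (parabola_point b)" "a \<le> b" "Re z = real c" "c = a \<or> c = b"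
  shows "z = parabola_point c"
proof -
  have "Im z = (Re z)\<^sup>2"
    using chord_of_parabola(3)[OF assms(1,2)] assms(3,4) by auto
  then show ?thesis using assms(3) by (simp add: parabola_point_def complex_eq_iff)
qed

lemma vertex_on_chord_of_parabola:
  assumes "parabola_point n \<in> closed_segment (parabola_point a) (parabola_point b)" "a \<le> b"
  shows "n = a \<or> n = b"
  using chord_of_parabola(3)[OF assms] by (auto simp: parabola_point_def)

text \<open>At a common point both chords have the same height above the parabola. Intervals that do
  not interleave are nested or share at most an endpoint; strictly inside the inner one of two
  nested intervals, the outer chord is strictly higher.\<close>

lemma chords_of_parabola_meet:
  assumes z: "z \<in> closed_segment (parabola_point a) (parabola_point b)" "z \<in> closed_segment (parabola_point c) (parabola_point d)"
    and ab: "a < b" and cd: "c < d" and ne: "(a, b) \<noteq> (c, d)"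
    and noncross: "\<not> (a < c \<and> c < b \<and> b < d)" "\<not> (c < a \<and> a < d \<and> d < b)"
  shows "z \<in> {parabola_point a, parabola_point b, parabola_point c, parabola_point d}"
proof -
  note 1 = chord_of_parabola[OF z(1) less_imp_le[OF ab]]
  note 2 = chord_of_parabola[OF z(2) less_imp_le[OF cd]]
  note v1 = chord_point_on_parabola[OF z(1) less_imp_le[OF ab]]
  note v2 = chord_point_on_parabola[OF z(2) less_imp_le[OF cd]]
  define x where "x = Re z"
  have eq: "(x - real a) * (real b - x) = (x - real c) * (real d - x)"
    using 1(3) 2(3) by (simp add: x_def)
  have nested: "x = real c' \<or> x = real d'"
    if "(x - real a') * (real b' - x) = (x - real c') * (real d' - x)"
      "a' \<le> c'" "d' \<le> b'" "(a', b') \<noteq> (c', d')" "real c' \<le> x" "x \<le> real d'" for a' b' c' d' :: nat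
  proof (rule ccontr)
    assume "\<not> (x = real c' \<or> x = real d')"
    then have pos: "0 < x - real c'" "0 < real d' - x" using that(5,6) by auto
    show False
    proof (cases "a' = c'")
      case True
      then have "real b' = real d'" using that(1) pos by auto
      then show False using True that(4) by simp
    next
      case False
      then have "(x - real c') * (real d' - x) < (x - real a') * (real d' - x)"
        using pos that(2) by (intro mult_strict_right_mono) auto
      also have "\<dots> \<le> (x - real a') * (real b' - x)"
        using pos that(2,3) by (intro mult_left_mono) auto
      finally show False using that(1) by simp
    qed
  qed
  consider "b \<le> c" | "d \<le> a" | "a \<le> c" "d \<le> b" | "c \<le> a" "b \<le> d"
    using noncross by linarith
  then show ?thesis
  proof cases
    case 1
    then have "Re z = real b" using \<open>Re z \<le> real b\<close> 2(1) by simp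
    then show ?thesis using v1 by blast
  next
    case 2
    then have "Re z = real a" using \<open>real a \<le> Re z\<close> \<open>Re z \<le> real d\<close> by simp
    then show ?thesis using v1 by blast
  next
    case 3
    then have "x = real c \<or> x = real d"
      using nested[of a b c d] eq ne 2(1,2) by (simp add: x_def)
    then show ?thesis using v2 by (auto simp: x_def)
  next
    case 4
    then have "x = real a \<or> x = real b"
      using nested[of c d a b] eq[symmetric] ne 1(1,2) by (auto simp: x_def)
    then show ?thesis using v1 by (auto simp: x_def)
  qed
qed

text \<open>The vertical ray downwards from \<open>p\<close> avoids \<open>D\<close> and is
  unbounded, hence so is the component of \<open>p\<close>.\<close>

lemma below_parabola_subset_outside:
  assumes D: "\<And>z. z \<in> D \<Longrightarrow> (Re z)\<^sup>2 \<le> Im z" and p: "Im p < (Re p)\<^sup>2"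
  shows "p \<in> outside D"
proof -
  define ray where "ray = (\<lambda>y. Complex (Re p) y) ` {..Im p}"
  have "Complex (Re p) (Im p) \<in> ray" unfolding ray_def by blast
  then have "p \<in> ray" by simp
  have "ray \<subseteq> - D"
  proof
    fix z assume "z \<in> ray"
    then have "Im z < (Re z)\<^sup>2" using p by (auto simp: ray_def)
    then show "z \<in> - D" using D[of z] by auto
  qed
  moreover have "Topological_Spaces.connected ray"
    unfolding ray_def Complex_eq by (intro connected_continuous_image continuous_intros) auto
  ultimately have sub: "ray \<subseteq> connected_component_set (- D) p"
    using \<open>p \<in> ray\<close> by (intro connected_component_maximal)
  have "\<not> bounded ray"
  proof
    assume "bounded ray"
    then obtain B where B: "\<And>z. z \<in> ray \<Longrightarrow> norm z \<le> B" by (auto simp: bounded_iff)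
    define y where "y = min (Im p) (- \<bar>B\<bar> - 1)"
    have "Complex (Re p) y \<in> ray" unfolding ray_def y_def by auto
    then have "\<bar>y\<bar> \<le> B" using B abs_Im_le_cmod[of "Complex (Re p) y"] by fastforce
    then show False unfolding y_def by linarith
  qed
  then have "\<not> bounded (connected_component_set (- D) p)"
    using sub bounded_subset by blast
  then show ?thesis
    using \<open>ray \<subseteq> - D\<close> \<open>p \<in> ray\<close> by (auto simp: outside_def)
qed

text \<open>Draw each edge as a chord of the parabola. By convexity the drawing lies on or above the
  parabola, so every vertex can be approached from below within the unbounded face.\<close>

lemma outerplanar_if_noncrossing:
  fixes G :: "nat pair_pre_digraph"
  assumes "pair_graph G"
    and noncross: "\<And>a b c d. (a, b) \<in> parcs G \<Longrightarrow> (c, d) \<in> parcs G \<Longrightarrow> a < c \<Longrightarrow> c < b \<Longrightarrow> \<not> b < d"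
  shows "outerplanar G"
proof -
  interpret pair_graph G by fact
  define \<gamma> where "\<gamma> = (\<lambda>(u, v). linepath (parabola_point u) (parabola_point v))"
  have flip: "(v, u) \<in> parcs G" if "(u, v) \<in> parcs G" for u v
    using sym_arcs that by (auto simp: symmetric_def dest: symD)
  have ne: "u \<noteq> v" if "(u, v) \<in> parcs G" for u v
    using pair_no_loops[OF that] by simp
  have img: "path_image (\<gamma> (u, v)) = closed_segment (parabola_point u) (parabola_point v)" for u v
    by (simp add: \<gamma>_def)
  have img_sym: "path_image (\<gamma> (u, v)) = path_image (\<gamma> (v, u))" for u v
    by (simp add: \<gamma>_def closed_segment_commute)
  have vert: "n = u \<or> n = v" if "parabola_point n \<in> path_image (\<gamma> (u, v))" for n u v
    using vertex_on_chord_of_parabola[of n u v] vertex_on_chord_of_parabola[of n v u] that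
    by (cases "u \<le> v") (auto simp: img closed_segment_commute)
  have meet: "path_image (\<gamma> (a, b)) \<inter> path_image (\<gamma> (c, d)) \<subseteq> parabola_point ` pverts G"
    if "(a, b) \<in> parcs G" "(c, d) \<in> parcs G" "a < b" "c < d" "(c, d) \<noteq> (a, b)" for a b c d
  proof
    fix z assume "z \<in> path_image (\<gamma> (a, b)) \<inter> path_image (\<gamma> (c, d))"
    then have "z \<in> {parabola_point a, parabola_point b, parabola_point c, parabola_point d}"
      using chords_of_parabola_meet[of z a b c d] noncross[OF that(1,2)] noncross[OF that(2,1)]
        that(3-5) by (auto simp: img)
    then show "z \<in> parabola_point ` pverts G"
      using in_arcsD1 in_arcsD2 that(1,2) by blast
  qed
  have meet': "path_image (\<gamma> e) \<inter> path_image (\<gamma> f) \<subseteq> parabola_point ` pverts G"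
    if asm: "e \<in> parcs G" "f \<in> parcs G" "f \<noteq> e" "f \<noteq> prod.swap e" for e f
  proof -
    obtain a b c d where ef: "e = (a, b)" "f = (c, d)" by fastforce
    consider "a < b" "c < d" | "b < a" "c < d" | "a < b" "d < c" | "b < a" "d < c"
      using ne[of a b] ne[of c d] asm(1,2) ef by (metis linorder_neqE_nat)
    then show ?thesis
    proof cases
      case 1
      then show ?thesis using meet[of a b c d] asm by (simp add: ef)
    next
      case 2
      then show ?thesis using meet[of b a c d] asm flip[of a b]
        by (auto simp: ef img_sym[of a b])
    next
      case 3
      then show ?thesis using meet[of a b d c] asm flip[of c d]
        by (auto simp: ef img_sym[of c d])
    next
      case 4
      then show ?thesis using meet[of b a d c] asm flip[of a b] flip[of c d]
        by (auto simp: ef img_sym[of a b] img_sym[of c d])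
    qed
  qed
  have "plane_drawing G parabola_point \<gamma>"
    unfolding plane_drawing_def
  proof (intro conjI ballI impI)
    show "inj_on parabola_point (pverts G)" using inj_parabola_point by (rule inj_on_subset) simp
  next
    fix e assume e: "e \<in> parcs G"
    obtain u v where uv: "e = (u, v)" by fastforce
    have "parabola_point u \<noteq> parabola_point v" using ne e uv inj_parabola_point by (auto dest: injD)
    moreover have "parabola_point u \<in> parabola_point ` pverts G" "parabola_point v \<in> parabola_point ` pverts G"
      using e uv in_arcsD1 in_arcsD2 by auto
    then have "path_image (\<gamma> (u, v)) \<inter> parabola_point ` pverts G = {parabola_point u, parabola_point v}"
      using vert[of _ u v] by (auto simp: img)
    ultimately show "case e of (u, v) \<Rightarrow>
        Path_Connected.arc (\<gamma> (u, v)) \<and> pathstart (\<gamma> (u, v)) = parabola_point u \<and> pathfinish (\<gamma> (u, v)) = parabola_point v \<and>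
        \<gamma> (v, u) = reversepath (\<gamma> (u, v)) \<and>
        path_image (\<gamma> (u, v)) \<inter> parabola_point ` pverts G = {parabola_point u, parabola_point v}"
      by (simp add: uv \<gamma>_def arc_linepath)
  qed (use meet' in blast)
  moreover have "parabola_point ` pverts G \<subseteq> frontier (outside (drawing_points G parabola_point \<gamma>))"
  proof
    fix p assume "p \<in> parabola_point ` pverts G"
    then obtain n where n: "n \<in> pverts G" "p = parabola_point n" by blast
    define D where "D = drawing_points G parabola_point \<gamma>"
    have above: "(Re z)\<^sup>2 \<le> Im z" if "z \<in> closed_segment (parabola_point u) (parabola_point v)" "u \<le> v" for z u v
      using chord_of_parabola[OF that] by (metis diff_ge_0_iff_ge mult_nonneg_nonneg)
    then have "(Re z)\<^sup>2 \<le> Im z" if "z \<in> path_image (\<gamma> (u, v))" for z u v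
      using above[of z u v] above[of z v u] that closed_segment_commute[of "parabola_point u" "parabola_point v"]
      unfolding img by (metis nat_le_linear)
    then have D: "(Re z)\<^sup>2 \<le> Im z" if "z \<in> D" for z
      using that by (auto simp: D_def drawing_points_def parabola_point_def)
    define q where "q m = p - \<i> * complex_of_real (inverse (real (Suc m)))" for m
    have "Im (q m) < (Re (q m))\<^sup>2" for m
      by (simp add: q_def n parabola_point_def)
    then have "q m \<in> outside D" for m
      using D below_parabola_subset_outside by blast
    moreover have "q \<longlonglongrightarrow> p - \<i> * complex_of_real 0"
      unfolding q_def by (intro tendsto_intros LIMSEQ_inverse_real_of_nat)
    ultimately have "p \<in> closure (outside D)"
      unfolding closure_sequential by auto
    moreover have "p \<in> D" using n by (auto simp: D_def drawing_points_def)
    then have "p \<notin> interior (outside D)"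
      using interior_subset outside_no_overlap[of D] by blast
    ultimately show "p \<in> frontier (outside (drawing_points G parabola_point \<gamma>))"
      by (simp add: frontier_def D_def)
  qed
  ultimately show ?thesis unfolding outerplanar_def by blast
qed

section \<open>The graph\<close>

text \<open>
  The vertices are numbered along a Hamiltonian cycle, starting with the hub \<open>0\<close>. The gadget
  \<open>i\<close> consists of the hub and \<open>30 * i + 1, \<dots>, 30 * i + 29\<close>, where the chord from
  \<open>30 * i + 9\<close> to \<open>30 * i + 27\<close> separates its two cycles; it is joined to the next gadget by
  \<open>30 * i + 30\<close>.
\<close>

definition link :: "nat \<Rightarrow> nat \<Rightarrow> bool" where
  "link u v \<longleftrightarrow> u < v \<and>
     (v = Suc u \<or> u = 0 \<and> v mod 30 \<in> {0, 1, 29} \<or> u mod 30 = 9 \<and> v = u + 18)"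

lemma mod_30_add_of_9:
  fixes u e :: nat
  assumes "u mod 30 = 9" "e \<le> 20"
  shows "(u + e) mod 30 = 9 + e"
proof -
  have "(u + e) mod 30 = (u mod 30 + e) mod 30" by (simp add: mod_add_left_eq)
  then show ?thesis using assms by simp
qed

text \<open>As \<open>c\<close> is not the hub and \<open>b\<close> lies strictly between
  \<open>c\<close> and \<open>d\<close>, the edge \<open>(c, d)\<close> is a gadget chord and
  \<open>b\<close> has residue 10 to 26. This excludes \<open>a = 0\<close>; were
  \<open>(a, b)\<close> a gadget chord too, \<open>c\<close> would lie strictly inside it and have
  residue above 9.\<close>

lemma link_noncrossing:
  assumes "link a b" "link c d" "a < c" "c < b"
  shows "\<not> b < d"
proof
  assume "b < d"
  then have d: "c mod 30 = 9" "d = c + 18"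
    using assms unfolding link_def by auto
  then consider "b mod 30 \<in> {0, 1, 29}" | "a mod 30 = 9" "b = a + 18"
    using assms unfolding link_def by auto
  then show False
  proof cases
    case 1
    have "b mod 30 = 9 + (b - c)"
      using mod_30_add_of_9[OF d(1), of "b - c"] d(2) \<open>c < b\<close> \<open>b < d\<close> by simp
    then show False using 1 d(2) \<open>c < b\<close> \<open>b < d\<close> by auto
  next
    case 2
    have "c mod 30 = 9 + (c - a)"
      using mod_30_add_of_9[OF 2(1), of "c - a"] 2(2) \<open>a < c\<close> \<open>c < b\<close> by simp
    then show False using d(1) \<open>a < c\<close> by simp
  qed
qed

definition necklace :: "nat \<Rightarrow> nat pair_pre_digraph" where
  "necklace k =
     \<lparr>pverts = {0..30 * k},
      parcs = {(u, v). u \<le> 30 * k \<and> v \<le> 30 * k \<and> (link u v \<or> link v u)}\<rparr>"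

lemma pverts_necklace [simp]: "pverts (necklace k) = {0..30 * k}"
  by (simp add: necklace_def)

lemma in_parcs_necklace [simp]:
  "(u, v) \<in> parcs (necklace k) \<longleftrightarrow> u \<le> 30 * k \<and> v \<le> 30 * k \<and> (link u v \<or> link v u)"
  by (simp add: necklace_def)

lemma pair_graph_necklace: "pair_graph (necklace k)"
proof
  show "finite (parcs (necklace k))"
    by (rule finite_subset[of _ "{0..30 * k} \<times> {0..30 * k}"]) auto
qed (auto simp: link_def symmetric_def intro!: symI)

lemma outerplanar_necklace: "outerplanar (necklace k)"
proof (rule outerplanar_if_noncrossing[OF pair_graph_necklace])
  fix a b c d assume "(a, b) \<in> parcs (necklace k)" "(c, d) \<in> parcs (necklace k)" "a < c" "c < b"
  then show "\<not> b < d"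
    using link_noncrossing[of a b c d] by (auto simp: link_def)
qed

text \<open>The edge from the hub to the last joining vertex \<open>30 * k\<close> closes the
  Hamiltonian cycle.\<close>

lemma two_connected_necklace: "k \<ge> 1 \<Longrightarrow> two_connected (necklace k)"
  by (rule two_connected_if_Hamiltonian[of _ "30 * k"]) (auto simp: link_def)

section \<open>Distances to a vertex of a gadget\<close>

text \<open>
  The hub and the vertices \<open>30 * i, \<dots>, 30 * i + 30\<close> are local to gadget \<open>i\<close>. Their local positions
  are \<open>0, \<dots>, 30\<close>, where \<open>0\<close> is the hub, and \<open>31\<close> for the joining vertex \<open>30 * i\<close>, which does not
  exist for \<open>i = 0\<close>.
\<close>

definition outer :: "nat \<Rightarrow> nat \<Rightarrow> bool" where
  "outer i z \<longleftrightarrow> z \<noteq> 0 \<and> (z < 30 * i \<or> 30 * i + 30 < z)"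

definition local_pos :: "nat \<Rightarrow> nat \<Rightarrow> nat" where
  "local_pos i z = (if z = 0 then 0 else if z = 30 * i then 31 else z - 30 * i)"

text \<open>One table for all gadgets, so it lists 31 even for gadget 0. Therefore the existence
  claims below restrict neighbours to \<open>w \<le> 30\<close>.\<close>

definition local_nbrs :: "nat \<Rightarrow> nat list" where
  "local_nbrs r =
     (if r = 0 then [1, 29, 30, 31] else if r = 30 then [29, 0] else if r = 31 then [1, 0]
      else [r - 1, r + 1] @ (if r = 1 then [31] else if r = 9 then [27]
        else if r = 27 then [9] else if r = 29 then [0] else []))"

text \<open>The 13-cycle consists of the residues 0 to 9 and 27 to 29. From the rest of the 19-cycle
  the hub is reached through 9, at distance 4, or through 27, at distance 3. Residue 0 stands for
  the joining vertices.\<close>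

definition res_dist :: "nat \<Rightarrow> nat" where
  "res_dist r = (if r = 0 then 1 else if r \<le> 9 then min r (13 - r) else min (r - 5) (30 - r))"

text \<open>
  The distance to the hub, except for the junk value at the hub itself.
\<close>

definition hub_dist :: "nat \<Rightarrow> nat" where
  "hub_dist z = res_dist (z mod 30)"

lemma res_dist_simps [simp]:
  "res_dist 0 = 1" "res_dist (Suc 0) = 1" "res_dist 29 = 1" "res_dist 9 = 4" "res_dist 27 = 3"
  by (simp_all add: res_dist_def)

lemma res_dist_Suc:
  "r < 29 \<Longrightarrow> res_dist r \<le> Suc (res_dist (Suc r)) \<and> res_dist (Suc r) \<le> Suc (res_dist r)"
  unfolding res_dist_def by (auto simp: min_def)

lemma res_dist_descent:
  assumes "2 \<le> r" "r \<le> 28"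
  shows "\<exists>r'. 1 \<le> r' \<and> r' \<le> 29 \<and> res_dist r' < res_dist r \<and>
      (r' = Suc r \<or> r = Suc r' \<or> r = 9 \<and> r' = 27)"
proof -
  \<comment> \<open>At 9 both neighbours on the 30-gon are farther from the hub; only the chord to
    27 leads closer.\<close>
  have "list_all (\<lambda>r. res_dist (r - 1) < res_dist r \<or> res_dist (Suc r) < res_dist r \<or> r = 9)
      [2..<29]"
    by code_simp
  then consider "res_dist (r - 1) < res_dist r" | "res_dist (Suc r) < res_dist r" | "r = 9"
    unfolding list_all_iff set_upt using assms by force
  then show ?thesis
  proof cases
    case 1
    then show ?thesis using assms by (intro exI[of _ "r - 1"]) auto
  next
    case 2
    then show ?thesis using assms by (intro exI[of _ "Suc r"]) auto
  next
    case 3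
    then show ?thesis by (intro exI[of _ 27]) auto
  qed
qed

lemma res_dist_le_12: "r < 30 \<Longrightarrow> res_dist r \<le> 12"
  unfolding res_dist_def by (auto simp: min_def)

text \<open>The local part can be left only at the hub and the two joining vertices, and only
  towards neighbours of the hub. This reduces every edge to the finite table, to hub distances, or
  to such a crossing.\<close>

lemma link_cases:
  assumes "link u v"
  obtains "\<not> outer i u" "\<not> outer i v"
      "local_pos i v \<in> set (local_nbrs (local_pos i u))" "local_pos i u \<in> set (local_nbrs (local_pos i v))"
  | "outer i u" "outer i v" "hub_dist u \<le> Suc (hub_dist v)" "hub_dist v \<le> Suc (hub_dist u)"
  | "\<not> outer i u" "local_pos i u \<in> {0, 30, 31}" "outer i v" "hub_dist v = 1"
  | "outer i u" "hub_dist u = 1" "\<not> outer i v" "local_pos i v \<in> {0, 30, 31}"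
proof -
  consider (succ) "v = Suc u" | (hub) "u = 0" "v mod 30 \<in> {0, 1, 29}" "0 < v"
    | (chord) "u mod 30 = 9" "v = u + 18"
    using assms unfolding link_def by auto
  then show thesis
  proof cases
    case succ
    have dist: "hub_dist u \<le> Suc (hub_dist v) \<and> hub_dist v \<le> Suc (hub_dist u)"
    proof (cases "u mod 30 = 29")
      case True
      then have "v mod 30 = 0" using succ by (simp add: mod_Suc)
      then show ?thesis using True by (simp add: hub_dist_def)
    next
      case False
      then have "v mod 30 = Suc (u mod 30)" using succ by (simp add: mod_Suc)
      moreover have "u mod 30 < 30" by simp
      then have "u mod 30 < 29" using False by linarith
      ultimately show ?thesis using res_dist_Suc by (simp add: hub_dist_def)
    qed
    consider "u = 0" | "0 < u" "Suc u < 30 * i" | "0 < u" "Suc u = 30 * i" | "0 < u" "u = 30 * i"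
      | "30 * i < u" "u < 30 * i + 30" | "u = 30 * i + 30" | "30 * i + 30 < u"
      by linarith
    then show thesis
    proof cases
      case 1
      then show thesis using succ that(1,3)
        by (cases "i = 0") (auto simp: outer_def local_pos_def local_nbrs_def hub_dist_def)
    next
      case 2
      then show thesis using that(2) dist succ by (auto simp: outer_def)
    next
      case 3
      then have "Suc u mod 30 = 0" by simp
      then have "u mod 30 = 29" by (simp add: mod_Suc split: if_splits)
      then show thesis using that(4) 3 succ by (auto simp: outer_def local_pos_def hub_dist_def)
    next
      case 4
      then show thesis using that(1) succ by (auto simp: outer_def local_pos_def local_nbrs_def)
    next
      case 5
      then obtain e where "u = 30 * i + e" "0 < e" "e < 30"
        by (metis add_less_cancel_left less_imp_add_positive)
      then show thesis using that(1) succ by (auto simp: outer_def local_pos_def local_nbrs_def)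
    next
      case 6
      then have "v mod 30 = 1" using succ by (simp add: mod_Suc)
      then show thesis using that(3) 6 succ by (auto simp: outer_def local_pos_def hub_dist_def)
    next
      case 7
      then show thesis using that(2) dist succ by (auto simp: outer_def)
    qed
  next
    case hub
    show thesis
    proof (cases "outer i v")
      case True
      have "hub_dist v = 1" using hub by (auto simp: hub_dist_def)
      then show thesis using that(3) True hub by (auto simp: outer_def local_pos_def)
    next
      case False
      then obtain e where e: "v = 30 * i + e" "e \<le> 30"
        using hub(3) unfolding outer_def by (metis add_le_cancel_left le_Suc_ex not_less neq0_conv)
      then have "e mod 30 \<in> {0, 1, 29}" using hub(2) by simp
      then have "e \<in> {0, 1, 29, 30}" using e(2) by (cases "e = 30") auto
      then show thesis using that(1) False hub e by (auto simp: outer_def local_pos_def local_nbrs_def)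
    qed
  next
    case chord
    have "v mod 30 = 27" using chord mod_30_add_of_9[of u 18] by simp
    show thesis
    proof (cases "outer i u")
      case True
      moreover obtain m where m: "u = 30 * m + 9"
        using chord(1) by (metis mult_div_mod_eq)
      ultimately have "Suc m \<le> i \<or> Suc i \<le> m" unfolding outer_def by linarith
      then have "outer i v" using chord(2) m unfolding outer_def by linarith
      then show thesis using that(2) True chord \<open>v mod 30 = 27\<close> by (auto simp: hub_dist_def)
    next
      case False
      then obtain e where e: "u = 30 * i + e" "e \<le> 30"
        using chord(1) unfolding outer_def by (metis add_le_cancel_left le_Suc_ex not_less mod_0 zero_neq_numeral)
      then have "e mod 30 = 9" using chord(1) by simp
      then have "e = 9" using e(2) by (cases "e = 30") auto
      then show thesis using that(1) chord e by (auto simp: outer_def local_pos_def local_nbrs_def)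
    qed
  qed
qed

text \<open>
  A shortest path between two vertices of the 30-gon of a gadget uses its chord at most once.
\<close>

definition polygon_dist :: "nat \<Rightarrow> nat \<Rightarrow> nat" where
  "polygon_dist a b = min (a - b + (b - a)) (30 - (a - b + (b - a)))"

definition core_dist :: "nat \<Rightarrow> nat \<Rightarrow> nat" where
  "core_dist a b =
     min (polygon_dist a b) (Suc (min (polygon_dist a 9 + polygon_dist b 27) (polygon_dist a 27 + polygon_dist b 9)))"

text \<open>The two local neighbours of a joining vertex are adjacent to each other, so paths
  between other local vertices gain nothing by passing through it.\<close>

definition local_dist :: "nat \<Rightarrow> nat \<Rightarrow> nat" where
  "local_dist r j =
     (if r = 30 then Suc (min (core_dist 29 j) (core_dist 0 j))
      else if r = 31 then Suc (min (core_dist 1 j) (core_dist 0 j))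
      else core_dist r j)"

lemma local_dist_local_nbrs:
  assumes "2 \<le> j" "j < 28" "r < 32" "w \<in> set (local_nbrs r)"
  shows "local_dist r j \<le> Suc (local_dist w j)"
proof -
  have "list_all (\<lambda>j. list_all (\<lambda>r. list_all (\<lambda>w. local_dist r j \<le> Suc (local_dist w j)) (local_nbrs r))
      [0..<32]) [2..<28]"
    by code_simp
  then show ?thesis unfolding list_all_iff set_upt using assms by simp
qed

lemma local_dist_descent:
  assumes "2 \<le> j" "j < 28" "r < 32" "r \<noteq> j"
  shows "\<exists>w \<in> set (local_nbrs r). w \<le> 30 \<and> local_dist w j < local_dist r j"
proof -
  have "list_all (\<lambda>j. list_all (\<lambda>r. r = j \<or>
      list_ex (\<lambda>w. w \<le> 30 \<and> local_dist w j < local_dist r j) (local_nbrs r)) [0..<32]) [2..<28]"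
    by code_simp
  then show ?thesis
    unfolding list_all_iff list_ex_iff set_upt using assms by (metis atLeastLessThan_iff le0)
qed

lemma local_dist_hub:
  assumes "2 \<le> j" "j < 28" "r \<in> {0, 30, 31}"
  shows "local_dist r j \<le> Suc (local_dist 0 j)" "local_dist 0 j \<le> local_dist r j"
  using local_dist_local_nbrs[OF assms(1,2), of 0 29] local_dist_local_nbrs[OF assms(1,2), of 0 1] assms(3)
  by (auto simp: local_nbrs_def local_dist_def)

text \<open>The distance to \<open>30 * i + j\<close>. By \<open>local_dist_hub\<close>, entering
  through a joining vertex never beats entering through the hub, so from outside the distance splits
  at the hub.\<close>

definition gadget_dist :: "nat \<Rightarrow> nat \<Rightarrow> nat \<Rightarrow> nat" where
  "gadget_dist i j z = (if outer i z then local_dist 0 j + hub_dist z else local_dist (local_pos i z) j)"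

lemma local_pos_less: "\<not> outer i z \<Longrightarrow> local_pos i z < 32"
  by (auto simp: outer_def local_pos_def)

lemma local_pos_gadget [simp]: "0 < r \<Longrightarrow> r \<le> 30 \<Longrightarrow> local_pos i (30 * i + r) = r"
  by (simp add: local_pos_def)

lemma not_outer_gadget [simp]: "r \<le> 30 \<Longrightarrow> \<not> outer i (30 * i + r)"
  by (simp add: outer_def)

lemma gadget_dist_target: "2 \<le> j \<Longrightarrow> j < 28 \<Longrightarrow> gadget_dist i j (30 * i + j) = 0"
  by (simp add: gadget_dist_def local_dist_def core_dist_def polygon_dist_def)

lemma gadget_dist_link:
  assumes j: "2 \<le> j" "j < 28" and "link u v"
  shows "gadget_dist i j u \<le> Suc (gadget_dist i j v)" "gadget_dist i j v \<le> Suc (gadget_dist i j u)"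
proof -
  note hub = local_dist_hub[OF j]
  from \<open>link u v\<close> have "gadget_dist i j u \<le> Suc (gadget_dist i j v) \<and> gadget_dist i j v \<le> Suc (gadget_dist i j u)"
  proof (cases rule: link_cases[where i = i])
    case 1
    then show ?thesis using local_dist_local_nbrs[OF j] local_pos_less by (simp add: gadget_dist_def)
  next
    case 2
    then show ?thesis by (simp add: gadget_dist_def)
  next
    case 3
    then show ?thesis using hub[of "local_pos i u"] by (simp add: gadget_dist_def)
  next
    case 4
    then show ?thesis using hub[of "local_pos i v"] by (simp add: gadget_dist_def)
  qed
  then show "gadget_dist i j u \<le> Suc (gadget_dist i j v)" "gadget_dist i j v \<le> Suc (gadget_dist i j u)" by auto
qed

lemma link_of_local_nbrs:
  assumes "\<not> outer i z" "w \<in> set (local_nbrs (local_pos i z))" "w \<le> 30"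
  defines "y \<equiv> if w = 0 then 0 else 30 * i + w"
  shows "link z y \<or> link y z"
proof -
  consider "z = 0" | "z = 30 * i" "0 < z" | r where "z = 30 * i + r" "1 \<le> r" "r \<le> 30"
  proof -
    have "z = 0 \<or> z = 30 * i \<and> 0 < z \<or>
        z = 30 * i + (z - 30 * i) \<and> 1 \<le> z - 30 * i \<and> z - 30 * i \<le> 30"
      using assms(1) unfolding outer_def by linarith
    then show thesis using that by blast
  qed
  then show ?thesis
  proof cases
    case 1
    then have "w \<in> {1, 29, 30}" using assms(2,3) by (simp add: local_pos_def local_nbrs_def)
    then have "w \<noteq> 0" "w mod 30 \<in> {0, 1, 29}" by auto
    then show ?thesis using 1 by (simp add: link_def y_def)
  next
    case 2
    then have "w \<in> {0, 1}" using assms(2,3) by (auto simp: local_pos_def local_nbrs_def)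
    then show ?thesis using 2 by (auto simp: link_def y_def)
  next
    case 3
    then have w: "w \<in> set (local_nbrs r)" using assms(2) by simp
    consider "w = Suc r" | "r = Suc w" "w \<noteq> 0" | "w = 0" "r \<in> {1, 29, 30}"
      | "r = 9" "w = 27" | "r = 27" "w = 9"
      using w 3 assms(3) by (auto simp: local_nbrs_def split: if_splits)
    then show ?thesis
    proof cases
      case 3
      then have "r mod 30 \<in> {0, 1, 29}" by auto
      then show ?thesis using 3 \<open>z = 30 * i + r\<close> by (auto simp: link_def y_def)
    qed (use 3 in \<open>auto simp: link_def y_def\<close>)
  qed
qed

lemma gadget_dist_descent:
  assumes j: "2 \<le> j" "j < 28" and i: "i < k" and z: "z \<le> 30 * k" "z \<noteq> 30 * i + j"
  shows "\<exists>y \<le> 30 * k. (link z y \<or> link y z) \<and> gadget_dist i j y < gadget_dist i j z"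
proof (cases "outer i z")
  case False
  have "local_pos i z \<noteq> j" using z(2) j False by (auto simp: local_pos_def outer_def split: if_splits)
  then obtain w where w: "w \<in> set (local_nbrs (local_pos i z))" "w \<le> 30" "local_dist w j < local_dist (local_pos i z) j"
    using local_dist_descent[OF j] local_pos_less[OF False] by blast
  define y where "y = (if w = 0 then 0 else 30 * i + w)"
  have "link z y \<or> link y z" using link_of_local_nbrs[OF False w(1,2)] by (simp add: y_def)
  moreover have "\<not> outer i y" "local_pos i y = w"
    using w(2) by (auto simp: y_def outer_def local_pos_def)
  then have "gadget_dist i j y < gadget_dist i j z" using w(3) False by (simp add: gadget_dist_def)
  moreover have "30 * i + 30 \<le> 30 * k" using i by simp
  then have "y \<le> 30 * k" using w(2) by (simp add: y_def)
  ultimately show ?thesis by blast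
next
  case True
  define q r where "q = z div 30" and "r = z mod 30"
  have zqr: "z = 30 * q + r" and "r < 30" by (simp_all add: q_def r_def)
  show ?thesis
  proof (cases "r \<in> {0, 1, 29}")
    case r: True
    then have "link 0 z" using True by (simp add: link_def outer_def r_def)
    moreover have "hub_dist z = 1" using r by (auto simp: hub_dist_def r_def)
    then have "gadget_dist i j 0 < gadget_dist i j z" using True by (simp add: gadget_dist_def outer_def local_pos_def)
    ultimately show ?thesis by blast
  next
    case False
    then have r: "2 \<le> r" "r \<le> 28" using \<open>r < 30\<close> by auto
    then obtain r' where r': "1 \<le> r'" "r' \<le> 29" "res_dist r' < res_dist r"
        "r' = Suc r \<or> r = Suc r' \<or> r = 9 \<and> r' = 27"
      using res_dist_descent by blast
    define y where "y = 30 * q + r'"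
    \<comment> \<open>Residues 2 to 28 do not occur at the last vertex \<open>30 * k\<close>, so the
      whole gadget \<open>q\<close> belongs to the graph.\<close>
    have "q < k" using z(1) zqr r by linarith
    then have "30 * q + 30 \<le> 30 * k" by simp
    then have "y \<le> 30 * k" using r'(2) by (simp add: y_def)
    moreover have "link z y \<or> link y z"
      using r'(4) by (auto simp: link_def y_def zqr)
    moreover have "outer i y"
    proof -
      have "q \<noteq> i" using True r by (auto simp: outer_def zqr)
      then have "30 * q + 30 \<le> 30 * i \<or> 30 * i + 30 \<le> 30 * q" by linarith
      then show ?thesis using r'(1,2) by (auto simp: outer_def y_def)
    qed
    then have "gadget_dist i j y < gadget_dist i j z"
      using True r' r by (simp add: gadget_dist_def hub_dist_def y_def zqr)
    ultimately show ?thesis by blast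
  qed
qed

lemma zombie_move_necklace:
  assumes move: "zombie_move (necklace k) (30 * i + j) u w" and "i < k" and j: "2 \<le> j" "j < 28"
  shows "(link u w \<or> link w u) \<and> gadget_dist i j w < gadget_dist i j u"
proof
  show "link u w \<or> link w u"
    using move by (simp add: zombie_move_def)
  show "gadget_dist i j w < gadget_dist i j u"
    using move gadget_dist_target[OF j]
  proof (rule pair_graph.zombie_move_descends[OF pair_graph_necklace])
    fix x y assume "(x, y) \<in> parcs (necklace k)"
    then show "gadget_dist i j x \<le> Suc (gadget_dist i j y)" using gadget_dist_link[OF j] by auto
  next
    fix x assume "x \<in> pverts (necklace k)" "x \<noteq> 30 * i + j"
    then show "\<exists>y. (x, y) \<in> parcs (necklace k) \<and> gadget_dist i j y < gadget_dist i j x"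
      using gadget_dist_descent[OF j \<open>i < k\<close>, of x] by auto
  qed
qed

section \<open>Evading the zombies in an empty gadget\<close>

text \<open>
  The survivor is at local position \<open>2, \<dots>, 27\<close> in the phases \<open>0, \<dots>, 25\<close> and then goes round
  the 19-cycle \<open>9, \<dots>, 27\<close>. From phase 16 on everything is periodic.
\<close>

definition walk_pos :: "nat \<Rightarrow> nat" where
  "walk_pos q = (if q \<le> 25 then q + 2 else q - 17)"

text \<open>Phases 16 to 34 are one full turn of the 19-cycle: phase 34 is at position 17 and phase
  16 at 18. Thus 35 phases describe the infinite walk.\<close>

definition next_phase :: "nat \<Rightarrow> nat" where
  "next_phase q = (if q = 34 then 16 else Suc q)"

definition phase :: "nat \<Rightarrow> nat" where
  "phase t = (next_phase ^^ t) 0"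

lemma phase_0 [simp]: "phase 0 = 0" and phase_Suc [simp]: "phase (Suc t) = next_phase (phase t)"
  by (simp_all add: phase_def)

lemma phase_less: "phase t < 35"
  by (induction t) (auto simp: next_phase_def)

lemma walk_pos_bounds: "q < 35 \<Longrightarrow> 2 \<le> walk_pos q \<and> walk_pos q < 28"
  by (auto simp: walk_pos_def)

lemma link_walk_pos:
  assumes "q < 35"
  shows "link (30 * i + walk_pos q) (30 * i + walk_pos (next_phase q)) \<or>
    link (30 * i + walk_pos (next_phase q)) (30 * i + walk_pos q)"
proof -
  \<comment> \<open>The step at \<open>q = 25\<close> runs along the chord from 27 back to
    9.\<close>
  consider "q < 25" | "q = 25" | "25 < q" "q < 34" | "q = 34"
    using assms by linarith
  then show ?thesis
    by cases (auto simp: link_def walk_pos_def next_phase_def)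
qed

text \<open>
  The local positions at which a zombie can be in phase \<open>q\<close>: in the first 16 phases, the zombies
  with \<open>1 \<le> r \<le> q\<close> follow the survivor, and those at \<open>27, 28, 29\<close> come along the shorter side
  of the 13-cycle. A zombie at distance \<open>d\<close> from the hub reaches it in phase \<open>d\<close>, so that
  nobody is left outside after phase 12.
\<close>

definition local_inv :: "nat \<Rightarrow> nat \<Rightarrow> bool" where
  "local_inv q r \<longleftrightarrow>
     (if q < 16 then
        r = 0 \<and> q \<le> 12 \<or> r = 30 \<and> 6 \<le> q \<and> q \<le> 12 \<or> r = 31 \<and> q \<le> 11 \<or>
        1 \<le> r \<and> r \<le> q \<and> (q \<le> 6 \<or> q \<le> r + 4 \<or> 9 \<le> r) \<or>
        27 \<le> r \<and> r \<le> 29 \<and> 35 \<le> r + q \<and> r + q \<le> 42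
      else 9 \<le> r \<and> r \<le> 27 \<and> (walk_pos q + 19 - r) mod 19 \<in> {2..9})"

text \<open>Exhaustive check of all phases and positions; decreasing \<open>local_dist\<close> along
  \<open>local_nbrs\<close> expresses the zombie rule inside the gadget.\<close>

lemma local_inv_step:
  assumes "q < 35" "local_inv q r" "r < 32" "w \<in> set (local_nbrs r)" "local_dist w (walk_pos q) < local_dist r (walk_pos q)"
  shows "local_inv (next_phase q) w \<and> w \<noteq> walk_pos q"
proof -
  have "list_all (\<lambda>q. list_all (\<lambda>r. local_inv q r \<longrightarrow>
      list_all (\<lambda>w. local_dist w (walk_pos q) < local_dist r (walk_pos q) \<longrightarrow> local_inv (next_phase q) w \<and> w \<noteq> walk_pos q)
        (local_nbrs r)) [0..<32]) [0..<35]"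
    by code_simp
  then show ?thesis unfolding list_all_iff set_upt using assms by simp
qed

lemma local_inv_walk_pos:
  assumes "q < 35"
  shows "\<not> local_inv q (walk_pos q)"
proof -
  have "list_all (\<lambda>q. \<not> local_inv q (walk_pos q)) [0..<35]"
    by code_simp
  then show ?thesis unfolding list_all_iff set_upt using assms by simp
qed

lemma local_inv_enter:
  assumes "q < 12" "r \<in> {0, 30, 31}" "local_dist r (walk_pos q) \<le> local_dist 0 (walk_pos q)"
  shows "local_inv (Suc q) r"
proof -
  have "list_all (\<lambda>q. list_all (\<lambda>r. local_dist r (walk_pos q) \<le> local_dist 0 (walk_pos q) \<longrightarrow> local_inv (Suc q) r)
      [0, 30, 31]) [0..<12]"
    by code_simp
  then show ?thesis unfolding list_all_iff set_upt using assms by auto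
qed

text \<open>Outside zombies come closer to the hub every round, and 12 bounds their initial
  distance. As this distance is at least 1 outside, entries happen only in phases below 12.\<close>

definition zombie_inv :: "nat \<Rightarrow> nat \<Rightarrow> nat \<Rightarrow> bool" where
  "zombie_inv i q z \<longleftrightarrow> (if outer i z then hub_dist z + q \<le> 12 else local_inv q (local_pos i z))"

lemma zombie_inv_step:
  assumes q: "q < 35" and inv: "zombie_inv i q u" and uw: "link u w \<or> link w u"
    and less: "gadget_dist i (walk_pos q) w < gadget_dist i (walk_pos q) u"
  shows "zombie_inv i (next_phase q) w \<and> w \<noteq> 30 * i + walk_pos q"
proof -
  define j where "j = walk_pos q"
  have j: "2 \<le> j" "j < 28" using walk_pos_bounds[OF q] by (simp_all add: j_def)
  have local_pos_walk_pos: "\<not> outer i (30 * i + j)" "local_pos i (30 * i + j) = j" using j by auto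
  note hub = local_dist_hub[OF j]
  consider (local) "\<not> outer i u" "\<not> outer i w" "local_pos i w \<in> set (local_nbrs (local_pos i u))"
    | (out) "outer i u" "outer i w"
    | (leave) "\<not> outer i u" "local_pos i u \<in> {0, 30, 31}" "outer i w" "hub_dist w = 1"
    | (enter) "outer i u" "hub_dist u = 1" "\<not> outer i w" "local_pos i w \<in> {0, 30, 31}"
    using uw by (elim disjE link_cases[where i = i]) simp_all
  then show ?thesis
  proof cases
    case local
    then have "local_inv (next_phase q) (local_pos i w) \<and> local_pos i w \<noteq> j"
      using local_inv_step[OF q] inv less local_pos_less[OF local(1)] by (simp add: zombie_inv_def gadget_dist_def j_def)
    then show ?thesis using local(2) local_pos_walk_pos by (auto simp: zombie_inv_def j_def)
  next
    case out
    then have "hub_dist w < hub_dist u" using less by (simp add: gadget_dist_def)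
    moreover have "hub_dist u + q \<le> 12" using inv out by (simp add: zombie_inv_def)
    ultimately have "zombie_inv i (next_phase q) w" using out by (simp add: zombie_inv_def next_phase_def)
    then show ?thesis using out local_pos_walk_pos by (auto simp: j_def)
  next
    \<comment> \<open>Impossible: the outside vertex has distance \<open>local_dist 0 j + 1\<close>,
      and no exit is farther away than that.\<close>
    case leave
    then show ?thesis using less hub(1)[OF leave(2)] by (simp add: gadget_dist_def j_def)
  next
    case enter
    then have "q < 12" using inv by (simp add: zombie_inv_def)
    have "local_dist (local_pos i w) j \<le> local_dist 0 j" using less enter by (simp add: gadget_dist_def j_def)
    then have "local_inv (Suc q) (local_pos i w)"
      using local_inv_enter[OF \<open>q < 12\<close> enter(4)] by (simp add: j_def)
    then have "zombie_inv i (next_phase q) w" using enter \<open>q < 12\<close> by (simp add: zombie_inv_def next_phase_def)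
    moreover have "local_pos i w \<noteq> j" using enter(4) j by auto
    ultimately show ?thesis using local_pos_walk_pos by (auto simp: j_def)
  qed
qed

lemma evading_walk_necklace:
  assumes "i < k" and Z0: "\<And>z. z \<in> set Z0 \<Longrightarrow> z \<notin> {30 * i + 1..30 * i + 30}"
  shows "evading_walk (necklace k) Z0 (\<lambda>t. 30 * i + walk_pos (phase t))"
proof (rule evading_walk_by_invariant[where I = "\<lambda>t. zombie_inv i (phase t)"])
  have top: "30 * i + walk_pos (phase t) \<le> 30 * k" for t
    using walk_pos_bounds[OF phase_less, of t] \<open>i < k\<close> by linarith
  from top[of 0] show "30 * i + walk_pos (phase 0) \<in> pverts (necklace k)" by simp
  show "survivor_move (necklace k) (30 * i + walk_pos (phase t)) (30 * i + walk_pos (phase (Suc t)))" for t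
    using link_walk_pos[OF phase_less, of i t] top[of t] top[of "Suc t"] by (simp add: survivor_move_def)
next
  \<comment> \<open>Initially only the hub and the joining vertex \<open>30 * i\<close> of the local
    part may be occupied, which \<open>local_inv 0\<close> permits.\<close>
  fix z assume "z \<in> set Z0"
  then have z: "z \<notin> {30 * i + 1..30 * i + 30}" by (rule Z0)
  have "z mod 30 < 30" by simp
  then have "hub_dist z \<le> 12" unfolding hub_dist_def by (rule res_dist_le_12)
  then show "zombie_inv i (phase 0) z"
    using z by (auto simp: zombie_inv_def outer_def local_pos_def local_inv_def)
next
  fix t z w
  assume "zombie_inv i (phase t) z" "zombie_move (necklace k) (30 * i + walk_pos (phase t)) z w"
  then show "zombie_inv i (phase (Suc t)) w \<and> w \<noteq> 30 * i + walk_pos (phase t)"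
    using zombie_inv_step[OF phase_less] zombie_move_necklace \<open>i < k\<close> walk_pos_bounds[OF phase_less] by simp
next
  show "\<not> zombie_inv i (phase t) (30 * i + walk_pos (phase t))" for t
    using local_inv_walk_pos[OF phase_less] walk_pos_bounds[OF phase_less, of t] by (simp add: zombie_inv_def)
qed

text \<open>Pigeonhole on \<open>k\<close> disjoint blocks. The hub is sent to block 0 by truncated
  subtraction, which at worst marks a free block as occupied.\<close>

lemma free_block:
  assumes "length Z0 < k"
  shows "\<exists>i<k. \<forall>z \<in> set Z0. z \<notin> {30 * i + 1..30 * i + 30}"
proof -
  define f where "f z = (z - 1) div 30" for z :: nat
  have "card (f ` set Z0) < card {..<k}"
    using assms card_length[of Z0] card_image_le[of "set Z0" f] by simp
  then have "\<not> {..<k} \<subseteq> f ` set Z0" using card_mono[of "f ` set Z0" "{..<k}"] by auto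
  then obtain i where i: "i < k" "i \<notin> f ` set Z0" by auto
  have "f z = i" if "z \<in> {30 * i + 1..30 * i + 30}" for z
    using that unfolding f_def by (intro div_nat_eqI) auto
  then show ?thesis using i by blast
qed

theorem theorem2:
  fixes k :: nat
  assumes "k \<ge> 2"
  shows "\<exists>G :: nat pair_pre_digraph.
           pair_graph G \<and> two_connected G \<and> outerplanar G \<and>
           card (pverts G) = 30 * k + 1 \<and>
           zombie_number G \<ge> k \<and>
           (\<forall>Z0. set Z0 \<subseteq> pverts G \<and> length Z0 \<le> k - 1 \<longrightarrow>
              (\<exists>\<sigma>. survivor_strategy_wins G Z0 \<sigma>))"
proof (rule exI[of _ "necklace k"], intro conjI allI impI)
  have evade: "\<exists>S. evading_walk (necklace k) Z0 S" if "length Z0 < k" for Z0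
    using free_block[OF that] evading_walk_necklace by blast
  show "pair_graph (necklace k)" by (rule pair_graph_necklace)
  show "two_connected (necklace k)" using assms by (intro two_connected_necklace) simp
  show "outerplanar (necklace k)" by (rule outerplanar_necklace)
  show "card (pverts (necklace k)) = 30 * k + 1" by simp
  show "zombie_number (necklace k) \<ge> k" by (rule zombie_number_ge) (simp_all add: evade)
  fix Z0 assume "set Z0 \<subseteq> pverts (necklace k) \<and> length Z0 \<le> k - 1"
  then have "length Z0 < k" using assms by linarith
  then show "\<exists>\<sigma>. survivor_strategy_wins (necklace k) Z0 \<sigma>"
    using evade survivor_strategy_of_evading_walk by blast
qed

end
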